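(* Let $m\ge 3$ be an integer and $e=(3^h-1)/2$, where $2\le h\le m-1$. The ternary cyclic code $\mathcal{C}_{(1,e)}$ has parameters $[3^m-1,\,3^m-1-2m,\,4]$ if and only if (a) $m$ is odd; (b) $h$ is even; (c) $\gcd(h,m)=1$; and (d) $\gcd(h-1,m)=1$.
   Context: Let $q=3^m$, $n=q-1$, $\alpha$ a generator of $\mathrm{GF}(q)^*$, and $m_a(x)$ the minimal polynomial of $a\in\mathrm{GF}(q)$ over $\mathrm{GF}(3)$. $C_j$ denotes the $3$-cyclotomic coset modulo $n$ containing $j$, i.e. $\{j,3j,3^2j,\dots\}$ mod $n$. For $1<e<q-1$ with $e\notin C_1$, $\mathcal{C}_{(1,e)}$ is the cyclic code of length $n$ over $\mathrm{GF}(3)$ with generator polynomial $m_\alpha(x)m_{\alpha^e}(x)$. *)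

theory Defs
  imports "HOL-Computational_Algebra.Polynomial"
begin

text \<open>The prime subfield GF(3) inside a finite field of order 3^m (its characteristic is 3).\<close>
definition prime_subfield :: "'a::field set" where
  "prime_subfield = range (of_nat :: nat \<Rightarrow> 'a)"

definition over_prime_field :: "'a::field poly \<Rightarrow> bool" where
  "over_prime_field p \<longleftrightarrow> (\<forall>i. coeff p i \<in> prime_subfield)"

definition min_poly :: "'a::field \<Rightarrow> 'a poly" where
  "min_poly a = (THE p. over_prime_field p \<and> lead_coeff p = 1 \<and> poly p a = 0 \<and>
     (\<forall>q. over_prime_field q \<and> q \<noteq> 0 \<and> poly q a = 0 \<longrightarrow> degree p \<le> degree q))"

definition cyclic_code :: "nat \<Rightarrow> 'a::field poly \<Rightarrow> 'a poly set" where
  "cyclic_code n g = {c. over_prime_field c \<and> degree c < n \<and>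
                         (\<exists>f. over_prime_field f \<and> c = g * f)}"

definition hamming_weight :: "'a::zero poly \<Rightarrow> nat" where
  "hamming_weight c = card {i. coeff c i \<noteq> 0}"

text \<open>A ternary code C of length n has parameters [n,k,d]: it has 3^k codewords
  (dimension k), and minimum distance (= minimum nonzero weight, C linear) d.\<close>
definition ternary_code_params :: "'a::field poly set \<Rightarrow> nat \<Rightarrow> nat \<Rightarrow> nat \<Rightarrow> bool" where
  "ternary_code_params C n k d \<longleftrightarrow>
     (\<forall>c\<in>C. degree c < n) \<and> card C = 3 ^ k \<and>
     (\<exists>c\<in>C. c \<noteq> 0 \<and> hamming_weight c = d) \<and>
     (\<forall>c\<in>C. c \<noteq> 0 \<longrightarrow> d \<le> hamming_weight c)"

end

theory Submission
  imports Defs "HOL-Computational_Algebra.Primes"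
begin

text \<open>
  For even \<open>e\<close>, a nonzero codeword of weight at most 3 amounts to some \<open>x \<notin> {0, 1, -1}\<close> with
  \<open>(x + 1)\<^sup>e = \<plusminus> (x\<^sup>e + 1)\<close>. Since \<open>2e + 1 = 3\<^sup>h\<close>, squaring and multiplying by
  \<open>x + 1\<close> turns this into \<open>(x\<^sup>e - 1) (x\<^sup>e - x) = 0\<close>. If \<open>x\<^sup>e = 1\<close>, then \<open>x\<close> is fixed by the
  \<open>h\<close>-th power of the Frobenius map; if \<open>x\<^sup>e = x\<close>, it is fixed by the \<open>(h - 1)\<close>-th power.
  Such \<open>x\<close> outside the prime field exist unless the two coprimality conditions hold.
  For odd \<open>e\<close> the word \<open>1 + X\<^bsup>n/2\<^esup>\<close> has weight 2, and \<open>e\<close> has the parity of \<open>h\<close>.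
  A sphere-packing count always yields a codeword of weight at most 4.
\<close>

section \<open>Auxiliary facts on polynomials and powers of three\<close>

lemma poly_eq_sum_support:
  fixes c :: "'a::comm_semiring_1 poly"
  shows "poly c x = (\<Sum>i | coeff c i \<noteq> 0. coeff c i * x ^ i)"
  unfolding poly_altdef
  by (intro sum.mono_neutral_right) (auto simp: le_degree)

lemma hamming_weight_le:
  assumes "finite A" "\<And>i. i \<notin> A \<Longrightarrow> coeff c i = 0"
  shows "hamming_weight c \<le> card A"
  unfolding hamming_weight_def using assms by (intro card_mono) auto

text \<open>This is the halved form of \<open>3 ^ g - 1\<close> dividing \<open>3 ^ k - 1\<close>: a
  power of \<open>2 * D + 1\<close> is 1 modulo \<open>2 * D\<close>, and both sides can then be
  halved.\<close>

lemma half_power_dvd: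
  fixes D E g k :: nat
  assumes "g dvd k" "2 * D + 1 = 3 ^ g" "2 * E + 1 = 3 ^ k"
  shows "D dvd E"
proof -
  obtain j where j: "k = g * j" using assms(1) by blast
  have "\<exists>c. (2 * D + 1) ^ j = 1 + 2 * D * c"
  proof (induction j)
    case (Suc j)
    then obtain c where "(2 * D + 1) ^ j = 1 + 2 * D * c" by blast
    then have "(2 * D + 1) ^ Suc j = 1 + 2 * D * (1 + c + 2 * D * c)"
      by (simp add: algebra_simps)
    then show ?case by blast
  qed (auto intro: exI[of _ 0])
  then obtain c where "(2 * D + 1) ^ j = 1 + 2 * D * c" by blast
  moreover have "(2 * D + 1) ^ j = 2 * E + 1"
    unfolding assms(2,3) j by (simp add: power_mult)
  ultimately show ?thesis by auto
qed

lemma odd_power_half: obtains D :: nat where "2 * D + 1 = 3 ^ g"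
proof -
  have "odd (3 ^ g :: nat)" by simp
  then show ?thesis using that by (metis oddE)
qed

text \<open>Polynomials of degree below \<open>k\<close> correspond to coefficient lists of length
  exactly \<open>k\<close>, padded with zeros; this is where \<open>0 \<in> S\<close>
  enters.\<close>

lemma card_polys_coeffs_in:
  fixes S :: "'a::zero set"
  assumes "finite S" "0 \<in> S"
  shows "card {p. (\<forall>i. coeff p i \<in> S) \<and> (\<forall>i\<ge>k. coeff p i = 0)} = card S ^ k"
proof -
  have "bij_betw Poly {xs. set xs \<subseteq> S \<and> length xs = k}
      {p. (\<forall>i. coeff p i \<in> S) \<and> (\<forall>i\<ge>k. coeff p i = 0)}"
  proof (rule bij_betw_byWitness[where f' = "\<lambda>p. map (coeff p) [0..<k]"])
    show "\<forall>xs\<in>{xs. set xs \<subseteq> S \<and> length xs = k}. map (coeff (Poly xs)) [0..<k] = xs"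
      by (auto intro!: nth_equalityI simp: nth_default_def)
    show "\<forall>p\<in>{p. (\<forall>i. coeff p i \<in> S) \<and> (\<forall>i\<ge>k. coeff p i = 0)}. Poly (map (coeff p) [0..<k]) = p"
      by (auto intro!: poly_eqI simp: nth_default_def)
    show "Poly ` {xs. set xs \<subseteq> S \<and> length xs = k}
        \<subseteq> {p. (\<forall>i. coeff p i \<in> S) \<and> (\<forall>i\<ge>k. coeff p i = 0)}"
    proof clarify
      fix xs assume "set xs \<subseteq> S" and k: "k = length xs"
      then have "xs ! i \<in> S" if "i < length xs" for i using that nth_mem by blast
      then show "(\<forall>i. coeff (Poly xs) i \<in> S) \<and> (\<forall>i\<ge>length xs. coeff (Poly xs) i = 0)"
        using assms(2) by (simp add: nth_default_def)
    qed
  qed auto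
  then show ?thesis
    using card_lists_length_eq[OF assms(1)] by (simp add: bij_betw_same_card[symmetric])
qed

section \<open>Arithmetic in a field of order 3^m\<close>

locale ternary_field =
  fixes \<alpha> :: "'a::{field,finite}" and m :: nat
  assumes card_field: "card (UNIV :: 'a set) = 3 ^ m"
    and primitive: "\<alpha> \<noteq> 0" "\<And>x::'a. x \<noteq> 0 \<Longrightarrow> \<exists>k::nat. \<alpha> ^ k = x"
begin

lemma CHAR_eq_3: "CHAR('a) = 3"
proof -
  \<comment> \<open>Translation by 1 permutes the field, so the number of its elements is zero in
    the field.\<close>
  have "(\<Sum>x\<in>UNIV. x + 1) = (\<Sum>x\<in>UNIV. x :: 'a)"
    by (rule sum.reindex_bij_witness[of _ "\<lambda>x. x - 1" "\<lambda>x. x + 1"]) auto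
  then have "of_nat (3 ^ m) = (0::'a)"
    by (simp add: sum.distrib card_field)
  then have "CHAR('a) dvd 3 ^ m"
    by (simp only: of_nat_eq_0_iff_char_dvd)
  moreover have prime: "prime CHAR('a)"
    by (intro prime_CHAR_semidom finite_imp_CHAR_pos) simp
  ultimately have "CHAR('a) dvd 3"
    by (blast dest: prime_dvd_power)
  with prime show ?thesis
    by (simp add: primes_dvd_imp_eq)
qed

lemma three_eq_0: "(3::'a) = 0"
  by (metis CHAR_eq_3 of_nat_CHAR of_nat_numeral)

lemma two_eq: "(2::'a) = -1"
  using three_eq_0 by (metis add.commute add_eq_0_iff one_plus_numeral semiring_norm(3))

lemma minus_one_neq_one: "(-1::'a) \<noteq> 1"
  using two_eq by (metis add.inverse_inverse one_add_one one_neq_zero right_minus)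

lemma cube_add: "(x + y) ^ 3 = x ^ 3 + (y::'a) ^ 3"
  by (intro freshmans_dream) (simp_all add: CHAR_eq_3)

lemma cube_sum: "(\<Sum>i\<in>A. f i) ^ 3 = (\<Sum>i\<in>A. f i ^ 3 :: 'a)"
  by (intro freshmans_dream_sum) (simp_all add: CHAR_eq_3)

lemma frobenius_add: "(x + y) ^ 3 ^ k = x ^ 3 ^ k + (y::'a) ^ 3 ^ k"
  by (intro freshmans_dream'[of _ k]) (simp_all add: CHAR_eq_3)

lemma cube_eq_iff: "x ^ 3 = y ^ 3 \<longleftrightarrow> x = (y::'a)"
proof
  assume "x ^ 3 = y ^ 3"
  moreover have "(x - y) ^ 3 + y ^ 3 = x ^ 3"
    using cube_add[of "x - y" y] by simp
  ultimately show "x = y" by simp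
qed simp

lemma frobenius_eq_iff: "x ^ 3 ^ k = y ^ 3 ^ k \<longleftrightarrow> x = (y::'a)"
proof (induction k)
  case (Suc k)
  then show ?case
    using cube_eq_iff[of "x ^ 3 ^ k" "y ^ 3 ^ k"] by (simp add: mult.commute flip: power_mult)
qed simp

lemma cube_fixed_iff: "x ^ 3 = x \<longleftrightarrow> x = 0 \<or> x = 1 \<or> x = (-1::'a)"
proof -
  have "x ^ 3 - x = x * (x - 1) * (x + 1)"
    by (simp add: algebra_simps power3_eq_cube)
  then show ?thesis
    by (metis (no_types, lifting) add_eq_0_iff mult_eq_0_iff right_minus_eq minus_minus)
qed

lemma prime_subfield_eq: "prime_subfield = {0, 1, -1 :: 'a}"
proof
  have "of_nat k \<in> {0, 1, -1 :: 'a}" for k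
  proof (induction k)
    case (Suc k)
    then show ?case using two_eq by auto
  qed simp
  then show "prime_subfield \<subseteq> {0, 1, -1 :: 'a}"
    unfolding prime_subfield_def by blast
  show "{0, 1, -1 :: 'a} \<subseteq> prime_subfield"
    unfolding prime_subfield_def using two_eq
    by (auto intro: range_eqI[of _ _ 0] range_eqI[of _ _ 1] range_eqI[of _ _ 2])
qed

lemma prime_subfield_iff: "x \<in> prime_subfield \<longleftrightarrow> x ^ 3 = (x::'a)"
  unfolding prime_subfield_eq cube_fixed_iff by blast

lemma card_prime_subfield: "card (prime_subfield :: 'a set) = 3"
  unfolding prime_subfield_eq using minus_one_neq_one[symmetric] by simp

section \<open>Polynomials over the prime field as Frobenius-fixed polynomials\<close>

text \<open>A ring endomorphism of the polynomial ring whose fixed points are exactly the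
  polynomials over GF(3). Closure properties thereby become equations.\<close>

definition frob :: "'a poly \<Rightarrow> 'a poly" where
  "frob = map_poly (\<lambda>x. x ^ 3)"

lemma coeff_frob: "coeff (frob p) i = coeff p i ^ 3"
  by (simp add: frob_def coeff_map_poly)

lemma over_prime_field_iff: "over_prime_field p \<longleftrightarrow> frob p = (p :: 'a poly)"
  by (simp add: over_prime_field_def prime_subfield_iff poly_eq_iff coeff_frob)

lemma frob_mult: "frob (p * q) = frob p * frob q"
  by (rule poly_eqI) (simp add: coeff_frob coeff_mult cube_sum power_mult_distrib)

lemma frob_add: "frob (p + q) = frob p + frob q"
  by (rule poly_eqI) (simp add: coeff_frob cube_add)

lemma frob_uminus: "frob (- p) = - frob p"
  by (rule poly_eqI) (simp add: coeff_frob)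

lemma frob_prod: "frob (\<Prod>i\<in>A. f i) = (\<Prod>i\<in>A. frob (f i))"
  by (induction A rule: infinite_finite_induct) (simp_all add: frob_mult, simp_all add: frob_def)

lemma frob_linear: "frob [:- y, 1:] = [:- (y ^ 3), 1:]"
  by (simp add: frob_def map_poly_pCons)

lemma poly_frob: "poly (frob p) (x ^ 3) = poly p x ^ 3"
  by (induction p) (simp_all add: frob_def map_poly_pCons cube_add power_mult_distrib)

lemma over_prime_field_mult:
  "over_prime_field p \<Longrightarrow> over_prime_field q \<Longrightarrow> over_prime_field (p * q :: 'a poly)"
  by (simp add: over_prime_field_iff frob_mult)

lemma over_prime_field_add:
  "over_prime_field p \<Longrightarrow> over_prime_field q \<Longrightarrow> over_prime_field (p + q :: 'a poly)"
  by (simp add: over_prime_field_iff frob_add)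

lemma over_prime_field_diff:
  "over_prime_field p \<Longrightarrow> over_prime_field q \<Longrightarrow> over_prime_field (p - q :: 'a poly)"
  using frob_add[of p "- q"] by (simp add: over_prime_field_iff frob_uminus)

lemma over_prime_field_monom: "a \<in> {1, -1} \<Longrightarrow> over_prime_field (monom a i :: 'a poly)"
  by (auto simp: over_prime_field_def prime_subfield_eq)

text \<open>Applying \<open>frob\<close> to the product gives \<open>g * frob f = g * f\<close>, and
  \<open>g\<close> cancels.\<close>

lemma over_prime_field_quotient:
  assumes "over_prime_field (g * f :: 'a poly)" "over_prime_field g" "g \<noteq> 0"
  shows "over_prime_field f"
  using assms by (simp add: over_prime_field_iff frob_mult)

lemma poly_power_root:
  assumes "over_prime_field p" "poly p x = (0::'a)"
  shows "poly p (x ^ 3 ^ i) = 0"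
proof (induction i)
  case (Suc i)
  have "poly p ((x ^ 3 ^ i) ^ 3) = 0"
    using poly_frob[of p "x ^ 3 ^ i"] assms Suc by (simp add: over_prime_field_iff)
  then show ?case by (simp add: mult.commute flip: power_mult)
qed (use assms in simp)

section \<open>Frobenius orbits and minimal polynomials\<close>

text \<open>The conjugates of \<open>x\<close>; for \<open>x = \<alpha> ^ j\<close> these are the
  powers of \<alpha> with exponents in the cyclotomic coset of \<open>j\<close>.\<close>

definition orbit :: "'a \<Rightarrow> 'a set" where
  "orbit x = range (\<lambda>i. x ^ 3 ^ i)"

lemma self_in_orbit: "x \<in> orbit x"
  unfolding orbit_def by (rule range_eqI[of _ _ 0]) simp

lemma bij_cube_orbit: "bij_betw (\<lambda>y. y ^ 3) (orbit x) (orbit x)"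
proof -
  have "inj_on (\<lambda>y. y ^ 3) (orbit x)"
    by (simp add: inj_on_def cube_eq_iff)
  moreover have "(\<lambda>y. y ^ 3) ` orbit x \<subseteq> orbit x"
  proof
    fix y assume "y \<in> (\<lambda>y. y ^ 3) ` orbit x"
    then obtain i where "y = (x ^ 3 ^ i) ^ 3" unfolding orbit_def by blast
    then have "y = x ^ 3 ^ Suc i" by (simp add: mult.commute flip: power_mult)
    then show "y \<in> orbit x" unfolding orbit_def by blast
  qed
  ultimately show ?thesis
    by (simp add: bij_betw_def endo_inj_surj)
qed

definition root_poly :: "'a set \<Rightarrow> 'a poly" where
  "root_poly A = (\<Prod>y\<in>A. [:- y, 1:])"

lemma root_poly_neq_0: "root_poly A \<noteq> 0"
  by (simp add: root_poly_def)

lemma degree_root_poly: "degree (root_poly A) = card A"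
  unfolding root_poly_def by (subst degree_prod_eq_sum_degree) simp_all

lemma lead_coeff_root_poly: "lead_coeff (root_poly A) = 1"
  by (simp add: root_poly_def lead_coeff_prod)

lemma poly_root_poly: "poly (root_poly A) x = 0 \<longleftrightarrow> x \<in> A"
  by (auto simp: root_poly_def poly_prod)

lemma root_poly_dvd: "(\<And>y. y \<in> A \<Longrightarrow> poly p y = 0) \<Longrightarrow> root_poly A dvd p"
proof -
  have "finite A" by simp
  then show "(\<And>y. y \<in> A \<Longrightarrow> poly p y = 0) \<Longrightarrow> root_poly A dvd p"
  proof (induction A arbitrary: p rule: finite_induct)
    case empty
    then show ?case by (simp add: root_poly_def)
  next
    case (insert x A)
    then obtain q where q: "p = root_poly A * q" by (metis dvdE insertCI)
    have "poly p x = 0" using insert by simp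
    then have "poly q x = 0"
      using insert.hyps by (simp add: q poly_root_poly)
    then have "[:- x, 1:] dvd q" by (simp add: poly_eq_0_iff_dvd)
    then have "root_poly A * [:- x, 1:] dvd p" unfolding q by (rule mult_dvd_mono[OF dvd_refl])
    then show ?case using insert.hyps by (simp add: root_poly_def mult.commute)
  qed
qed

text \<open>Cubing only permutes the linear factors, so \<open>frob\<close> fixes the
  product.\<close>

lemma over_prime_field_root_poly_orbit: "over_prime_field (root_poly (orbit x))"
proof -
  have "frob (root_poly (orbit x)) = (\<Prod>y\<in>orbit x. [:- (y ^ 3), 1:])"
    by (simp add: root_poly_def frob_prod frob_linear)
  also have "\<dots> = root_poly (orbit x)"
    unfolding root_poly_def by (rule prod.reindex_bij_betw[OF bij_cube_orbit])
  finally show ?thesis by (simp add: over_prime_field_iff)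
qed

lemma root_poly_orbit_dvd:
  assumes "over_prime_field p" "poly p x = 0"
  shows "root_poly (orbit x) dvd p"
  by (rule root_poly_dvd) (use assms in \<open>auto simp: orbit_def poly_power_root\<close>)

lemma min_poly_eq: "min_poly x = root_poly (orbit x)"
  unfolding min_poly_def
proof (rule the_equality)
  show "over_prime_field (root_poly (orbit x)) \<and> lead_coeff (root_poly (orbit x)) = 1 \<and>
      poly (root_poly (orbit x)) x = 0 \<and>
      (\<forall>q. over_prime_field q \<and> q \<noteq> 0 \<and> poly q x = 0 \<longrightarrow> degree (root_poly (orbit x)) \<le> degree q)"
    by (auto simp: over_prime_field_root_poly_orbit lead_coeff_root_poly poly_root_poly self_in_orbit
        intro: dvd_imp_degree_le root_poly_orbit_dvd)
next
  \<comment> \<open>Any other candidate is a multiple of the orbit polynomial. Minimality bounds its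
    degree, so the cofactor is constant, and it is 1 because both polynomials are monic.\<close>
  fix p
  assume p: "over_prime_field p \<and> lead_coeff p = 1 \<and> poly p x = 0 \<and>
     (\<forall>q. over_prime_field q \<and> q \<noteq> 0 \<and> poly q x = 0 \<longrightarrow> degree p \<le> degree q)"
  then obtain f where f: "p = root_poly (orbit x) * f"
    using root_poly_orbit_dvd by (metis dvdE)
  have "f \<noteq> 0" using p f by auto
  have "degree p \<le> degree (root_poly (orbit x))"
    using p by (simp add: over_prime_field_root_poly_orbit root_poly_neq_0 poly_root_poly self_in_orbit)
  then have "degree f = 0"
    using \<open>f \<noteq> 0\<close> by (simp add: f degree_mult_eq root_poly_neq_0)
  moreover have "lead_coeff f = 1"
    using p f by (simp add: lead_coeff_mult lead_coeff_root_poly)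
  ultimately have "f = 1" by (metis degree_eq_zeroE lead_coeff_pCons(2) one_pCons)
  then show "p = root_poly (orbit x)" by (simp add: f)
qed

section \<open>The multiplicative group and iterates of Frobenius\<close>

definition n :: nat where "n = 3 ^ m - 1"

lemma card_nonzero: "card (UNIV - {0 :: 'a}) = n"
  by (simp add: card_Diff_singleton card_field n_def)

lemma n_pos: "n > 0"
proof -
  have "card {0, 1 :: 'a} \<le> card (UNIV :: 'a set)" by (intro card_mono) auto
  then show ?thesis by (simp add: card_field n_def)
qed

lemma power_n: "x \<noteq> 0 \<Longrightarrow> x ^ n = (1::'a)"
proof -
  assume x: "x \<noteq> 0"
  \<comment> \<open>Multiplication by \<open>x\<close> permutes the nonzero elements; comparing the
    two products yields \<open>x ^ n = 1\<close>.\<close>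
  have "(\<Prod>y\<in>UNIV - {0}. x * y) = \<Prod>(UNIV - {0})"
    by (rule prod.reindex_bij_witness[of _ "\<lambda>y. y / x" "\<lambda>y. x * y"]) (use x in auto)
  moreover have "(\<Prod>y\<in>UNIV - {0}. x * y) = x ^ n * \<Prod>(UNIV - {0})"
    by (simp add: prod.distrib card_nonzero)
  moreover have "\<Prod>(UNIV - {0::'a}) \<noteq> 0" by simp
  ultimately show ?thesis by simp
qed

lemma power_card: "x ^ 3 ^ m = (x::'a)"
proof (cases "x = 0")
  case False
  have "x ^ 3 ^ m = x ^ Suc n" using n_pos by (simp add: n_def)
  then show ?thesis using power_n[OF False] by (simp only: power_Suc mult_1_right)
qed simp

lemma primitive_less:
  assumes "x \<noteq> (0::'a)"
  obtains k where "k < n" "x = \<alpha> ^ k"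
proof -
  obtain k where k: "\<alpha> ^ k = x" using assms primitive(2) by blast
  have "\<alpha> ^ k = \<alpha> ^ (n * (k div n) + k mod n)" by simp
  also have "\<dots> = \<alpha> ^ (k mod n)"
    unfolding power_add power_mult by (simp add: power_n primitive)
  finally show ?thesis using that[of "k mod n"] n_pos k by simp
qed

text \<open>The map sends \<open>n\<close> exponents onto \<open>n\<close> nonzero elements, hence
  is injective.\<close>

lemma inj_on_power: "inj_on (\<lambda>k. \<alpha> ^ k) {..<n}"
proof -
  have "(\<lambda>k. \<alpha> ^ k) ` {..<n} = UNIV - {0}"
    using primitive_less by (auto simp: primitive(1))
  then show ?thesis
    by (intro eq_card_imp_inj_on) (simp_all add: card_nonzero)
qed

lemma power_eq_iff: "i < n \<Longrightarrow> j < n \<Longrightarrow> \<alpha> ^ i = \<alpha> ^ j \<longleftrightarrow> i = j"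
  using inj_on_power by (auto dest: inj_onD)

lemma frobenius_add_exponent: "x ^ 3 ^ (i + j) = (x ^ 3 ^ i) ^ 3 ^ j"
  for x :: 'a
  by (simp only: power_add power_mult)

lemma frobenius_fixed_mult: "x ^ 3 ^ k = x \<Longrightarrow> x ^ 3 ^ (k * j) = x"
  for x :: 'a
proof (induction j)
  case (Suc j)
  then show ?case by (simp only: mult_Suc_right frobenius_add_exponent)
qed simp

lemma frobenius_mod: "x ^ 3 ^ (k mod m) = x ^ 3 ^ k"
  for x :: 'a
proof -
  have "x ^ 3 ^ k = x ^ 3 ^ (m * (k div m) + k mod m)" by simp
  also have "\<dots> = x ^ 3 ^ (k mod m)"
    by (simp only: frobenius_add_exponent frobenius_fixed_mult[OF power_card])
  finally show ?thesis by simp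
qed

text \<open>The \<open>m\<close>-th iterate of Frobenius is the identity, so by Bezout a suitable
  multiple of \<open>k\<close> acts like a single cubing.\<close>

lemma frobenius_fixed_coprime:
  fixes x :: 'a
  assumes "x ^ 3 ^ k = x" "gcd k m = 1"
  shows "x ^ 3 = x"
proof (cases "k = 0")
  case True
  with assms have "m = 1" by simp
  then show ?thesis using power_card[of x] by simp
next
  case False
  then obtain i j where "k * i = m * j + 1"
    using bezout_nat[of k m] assms(2) by auto
  then have "x = x ^ 3 ^ (m * j + 1)"
    using frobenius_fixed_mult[OF assms(1), of i] by simp
  also have "\<dots> = x ^ 3"
    by (simp only: frobenius_add_exponent frobenius_fixed_mult[OF power_card] power_one_right)
  finally show ?thesis by simp
qed

lemma m_pos: "m > 0"
  using n_pos unfolding n_def by (cases "m = 0") simp_all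

lemma card_orbit:
  assumes "\<And>d. 0 < d \<Longrightarrow> d < m \<Longrightarrow> x ^ 3 ^ d \<noteq> x"
  shows "card (orbit x) = m"
proof -
  have "x ^ 3 ^ i \<in> (\<lambda>i. x ^ 3 ^ i) ` {..<m}" for i
    by (rule image_eqI[of _ _ "i mod m"]) (simp_all add: frobenius_mod m_pos)
  then have "orbit x = (\<lambda>i. x ^ 3 ^ i) ` {..<m}"
    unfolding orbit_def by blast
  moreover have "inj_on (\<lambda>i. x ^ 3 ^ i) {..<m}"
  proof (rule linorder_inj_onI)
    fix i j assume ij: "i < j" "i \<in> {..<m}" "j \<in> {..<m}"
    have "x ^ 3 ^ j = (x ^ 3 ^ (j - i)) ^ 3 ^ i"
      using ij by (simp flip: frobenius_add_exponent)
    moreover have "x ^ 3 ^ (j - i) \<noteq> x" using assms ij by simp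
    ultimately show "x ^ 3 ^ i \<noteq> x ^ 3 ^ j"
      by (metis frobenius_eq_iff)
  qed auto
  ultimately show ?thesis by (simp add: card_image)
qed

text \<open>The witness is \<alpha> to the power \<open>n div D\<close>. Its order is
  \<open>D > 2\<close>, so its square is not 1, which excludes both 1 and -1.\<close>

lemma exists_small_order:
  assumes "D dvd n" "D > 2"
  obtains x where "x \<noteq> 0" "x ^ D = (1::'a)" "x \<noteq> 1" "x \<noteq> -1"
proof -
  obtain k where k: "n = D * k" using assms by blast
  have "k > 0" using n_pos k by simp
  have "2 * k < n" using k assms \<open>k > 0\<close> by simp
  have "(\<alpha> ^ k) ^ D = 1"
    using power_n[OF primitive(1)] by (simp add: k mult.commute flip: power_mult)
  moreover have "(\<alpha> ^ k) ^ 2 \<noteq> 1"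
    using power_eq_iff[of "2 * k" 0] \<open>2 * k < n\<close> \<open>k > 0\<close>
    by (simp add: mult.commute flip: power_mult)
  ultimately show ?thesis
    by (intro that[of "\<alpha> ^ k"]) (auto simp: primitive(1))
qed

text \<open>If \<open>g = gcd k m\<close> were at least 2, then \<open>D = (3 ^ g - 1) div 2\<close>
  would be at least 4 and would divide both \<open>E\<close> and \<open>n\<close>. An element of
  order \<open>D\<close> would violate the assumption.\<close>

lemma gcd_eq_1_if_no_small_order:
  assumes "2 * E + 1 = 3 ^ k" "\<And>x::'a. x \<noteq> 0 \<Longrightarrow> x ^ E = 1 \<Longrightarrow> x = 1 \<or> x = -1"
  shows "gcd k m = 1"
proof (rule ccontr)
  define g where "g = gcd k m"
  assume "gcd k m \<noteq> 1"
  then have "g \<noteq> 0" "g \<noteq> 1" using m_pos by (auto simp: g_def)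
  then have "g \<ge> 2" by linarith
  obtain D where D: "2 * D + 1 = (3::nat) ^ g" by (rule odd_power_half)
  obtain N where N: "2 * N + 1 = (3::nat) ^ m" by (rule odd_power_half)
  have "(3::nat) ^ 2 \<le> 3 ^ g" using \<open>g \<ge> 2\<close> by (intro power_increasing) auto
  then have "D > 2" using D by simp
  have "D dvd N" using half_power_dvd[OF _ D N] by (simp add: g_def)
  then have "D dvd n" unfolding n_def N[symmetric] by simp
  then obtain x :: 'a where x: "x \<noteq> 0" "x ^ D = 1" "x \<noteq> 1" "x \<noteq> -1"
    using \<open>D > 2\<close> by (rule exists_small_order)
  have "D dvd E" using half_power_dvd[OF _ D assms(1)] by (simp add: g_def)
  then have "x ^ E = 1" using x(2) by (auto simp: power_mult elim!: dvdE)
  then show False using assms(2) x by blast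
qed

lemma square_condition:
  fixes x :: 'a
  assumes e: "2 * e + 1 = 3 ^ h" and "x + 1 \<noteq> 0"
  shows "((x + 1) ^ e) ^ 2 = (x ^ e + 1) ^ 2 \<longleftrightarrow> x ^ e = 1 \<or> x ^ e = x"
proof -
  define y z where "y = x ^ e" and "z = (x + 1) ^ e"
  have "(x + 1) * z ^ 2 = (x + 1) ^ (2 * e + 1)"
    by (simp add: z_def mult.commute flip: power_mult)
  also have "\<dots> = x ^ (2 * e + 1) + 1"
    unfolding e by (simp add: frobenius_add)
  also have "x ^ (2 * e + 1) = x * y ^ 2"
    by (simp add: y_def mult.commute flip: power_mult)
  \<comment> \<open>The multiple of 3 is kept explicit so that the identity holds by plain ring
    algebra; characteristic 3 then removes it and leaves a factorisation.\<close>
  finally have "(x + 1) * (z ^ 2 - (y + 1) ^ 2) = - ((y - 1) * (y - x)) - 3 * (x * y + y)"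
    by (simp add: algebra_simps power2_eq_square)
  then have "(x + 1) * (z ^ 2 - (y + 1) ^ 2) = - ((y - 1) * (y - x))"
    by (simp add: three_eq_0)
  then have "(x + 1) * (z ^ 2 - (y + 1) ^ 2) = 0 \<longleftrightarrow> (y - 1) * (y - x) = 0"
    by (simp only: neg_equal_0_iff_equal)
  then have "z ^ 2 = (y + 1) ^ 2 \<longleftrightarrow> y = 1 \<or> y = x"
    using assms(2) by (simp only: mult_eq_0_iff right_minus_eq) blast
  then show ?thesis by (simp only: y_def z_def)
qed

end

text \<open>Writing \<open>2 * e + 1 = 3 ^ h\<close> avoids the truncating operations in \<open>e = (3 ^ h - 1) div 2\<close>.\<close>
locale ternary_code = ternary_field \<alpha> m for \<alpha> :: "'a::{field,finite}" and m :: nat +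
  fixes h e :: nat
  assumes m_ge_3: "3 \<le> m" and h_ge_2: "2 \<le> h" and h_less: "h < m" and e: "2 * e + 1 = 3 ^ h"
begin

section \<open>The orbits of \<alpha> and its e-th power\<close>

lemma n_eq: "n + 1 = 3 * 3 ^ (m - 1)"
proof -
  have "(3::nat) ^ m = 3 * 3 ^ (m - 1)"
    using m_pos power_minus_mult[of m "3::nat"] by simp
  then show ?thesis by (simp add: n_def)
qed

lemma power_bound: "9 \<le> (3::nat) ^ (m - 1)"
proof -
  have "(3::nat) ^ 2 \<le> 3 ^ (m - 1)" using m_ge_3 by (intro power_increasing) auto
  then show ?thesis by simp
qed

lemma power_le_bound: "k < m \<Longrightarrow> (3::nat) ^ k \<le> 3 ^ (m - 1)"
  by (intro power_increasing) auto

lemma card_orbit_primitive: "card (orbit \<alpha>) = m"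
proof (rule card_orbit)
  fix d assume d: "0 < d" "d < m"
  have "\<alpha> ^ 3 ^ d = \<alpha> ^ 1 \<longleftrightarrow> (3::nat) ^ d = 1"
    using power_le_bound[OF d(2)] power_bound n_eq by (intro power_eq_iff) linarith+
  then show "\<alpha> ^ 3 ^ d \<noteq> \<alpha>" using d by simp
qed

lemma card_orbit_power: "card (orbit (\<alpha> ^ e)) = m"
proof (rule card_orbit)
  fix d assume d: "0 < d" "d < m"
  show "(\<alpha> ^ e) ^ 3 ^ d \<noteq> \<alpha> ^ e"
  proof
    assume "(\<alpha> ^ e) ^ 3 ^ d = \<alpha> ^ e"
    then have "\<alpha> ^ (e * 3 ^ d) = \<alpha> ^ e" by (simp add: power_mult)
    \<comment> \<open>Doubling the exponents and adding \<open>3 ^ d + 1\<close> makes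
      \<open>2 * e + 1 = 3 ^ h\<close> appear on both sides, leaving only sums of two powers of
      3.\<close>
    then have "\<alpha> ^ (e * 3 ^ d + e * 3 ^ d + 3 ^ d + 1) = \<alpha> ^ (e + e + 3 ^ d + 1)"
      by (simp only: power_add)
    moreover have "e * 3 ^ d + e * 3 ^ d + 3 ^ d + 1 = (2 * e + 1) * 3 ^ d + 1" by simp
    moreover have "e + e + 3 ^ d + 1 = (2 * e + 1) + 3 ^ d" by simp
    ultimately have "\<alpha> ^ (3 ^ (h + d) + 1) = \<alpha> ^ (3 ^ h + 3 ^ d)"
      by (simp only: e power_add)
    moreover define r where "r = (h + d) mod m"
    ultimately have "\<alpha> ^ (3 ^ r + 1) = \<alpha> ^ (3 ^ h + 3 ^ d)"
      by (simp only: r_def power_add[of \<alpha>] frobenius_mod)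
    moreover have "r < m" using m_pos by (simp add: r_def)
    \<comment> \<open>Each power of 3 is at most \<open>3 ^ (m - 1)\<close>, a third of
      \<open>n + 1\<close>, so both exponents lie below \<open>n\<close> and must agree as integers.
      They differ modulo 3, as the left one is 1 or 2 and the right one 0.\<close>
    ultimately have eq: "(3::nat) ^ r + 1 = 3 ^ h + 3 ^ d"
      using power_le_bound[OF \<open>r < m\<close>] power_le_bound[OF d(2)] power_le_bound[OF h_less]
        power_bound n_eq by (subst (asm) power_eq_iff) linarith+
    have "3 dvd (3::nat) ^ h + 3 ^ d" using d h_ge_2 by simp
    then have "3 dvd (3::nat) ^ r + 1" by (simp only: eq)
    then have "r \<noteq> 0" by (auto intro!: Nat.gr0I simp flip: numeral_2_eq_2)
    then show False
      using \<open>3 dvd 3 ^ r + 1\<close> dvd_add_right_iff[of 3 "(3::nat) ^ r" 1] by simp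
  qed
qed

text \<open>This is the condition that \<open>e\<close> lies outside the cyclotomic coset of 1. A
  common element would force \<open>3 ^ h = 2 * 3 ^ r + 1\<close>, which is impossible for
  \<open>h \<ge> 2\<close>.\<close>

lemma orbits_disjoint: "orbit \<alpha> \<inter> orbit (\<alpha> ^ e) = {}"
proof (rule ccontr)
  assume "orbit \<alpha> \<inter> orbit (\<alpha> ^ e) \<noteq> {}"
  then obtain i j where "(\<alpha> ^ e) ^ 3 ^ j = \<alpha> ^ 3 ^ i"
    unfolding orbit_def by (smt (verit) Int_iff equals0I imageE)
  \<comment> \<open>Another \<open>(m - 1) * j\<close> Frobenius steps complete the left side to
    \<open>m * j\<close> steps, which is the identity.\<close>
  then have "(\<alpha> ^ e) ^ 3 ^ (j + (m - 1) * j) = \<alpha> ^ 3 ^ (i + (m - 1) * j)"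
    by (simp only: frobenius_add_exponent)
  moreover have "j + (m - 1) * j = m * j" using m_pos by (cases m) simp_all
  moreover define r where "r = (i + (m - 1) * j) mod m"
  ultimately have "\<alpha> ^ e = \<alpha> ^ 3 ^ r"
    by (simp only: r_def frobenius_mod frobenius_fixed_mult[OF power_card])
  then have "\<alpha> ^ (e + e + 1) = \<alpha> ^ (3 ^ r + 3 ^ r + 1)"
    by (simp only: power_add)
  then have "\<alpha> ^ (3 ^ h) = \<alpha> ^ (2 * 3 ^ r + 1)"
    unfolding mult_2[symmetric] e .
  moreover have "r < m" using m_pos by (simp add: r_def)
  ultimately have eq: "(3::nat) ^ h = 2 * 3 ^ r + 1"
    using power_le_bound[OF \<open>r < m\<close>] power_le_bound[OF h_less] power_bound n_eq
    by (subst (asm) power_eq_iff) linarith+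
  \<comment> \<open>Divisibility by 9 excludes \<open>r = 0\<close>, where the right side is 3; for
    positive \<open>r\<close> it is 1 modulo 3.\<close>
  have "9 dvd (3::nat) ^ h" using le_imp_power_dvd[OF h_ge_2, of "3::nat"] by simp
  then have "9 dvd 2 * (3::nat) ^ r + 1" by (simp only: eq)
  then have "r \<noteq> 0" and "3 dvd 2 * (3::nat) ^ r + 1"
    using dvd_trans[of 3 9 "2 * (3::nat) ^ r + 1"] by (auto intro!: Nat.gr0I)
  then show False
    using dvd_add_right_iff[of 3 "2 * (3::nat) ^ r" 1] by simp
qed

section \<open>The code, its zeros and its dimension\<close>

definition code :: "'a poly set" where
  "code = cyclic_code n (min_poly \<alpha> * min_poly (\<alpha> ^ e))"

definition generator :: "'a poly" where
  "generator = root_poly (orbit \<alpha> \<union> orbit (\<alpha> ^ e))"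

lemma generator_eq: "min_poly \<alpha> * min_poly (\<alpha> ^ e) = generator"
  unfolding min_poly_eq generator_def root_poly_def
  by (rule prod.union_disjoint[symmetric]) (simp_all add: orbits_disjoint)

lemma degree_generator: "degree generator = 2 * m"
  by (simp add: generator_def degree_root_poly card_Un_disjoint orbits_disjoint
      card_orbit_primitive card_orbit_power)

lemma over_prime_field_generator: "over_prime_field generator"
  by (simp flip: generator_eq add: min_poly_eq over_prime_field_mult over_prime_field_root_poly_orbit)

lemma generator_neq_0: "generator \<noteq> 0"
  by (simp add: generator_def root_poly_neq_0)

text \<open>Two zeros suffice: a polynomial over GF(3) vanishes on whole orbits, so the generator
  divides it, and the quotient is again over GF(3).\<close>

lemma code_iff:
  "c \<in> code \<longleftrightarrow> over_prime_field c \<and> degree c < n \<and> poly c \<alpha> = 0 \<and> poly c (\<alpha> ^ e) = 0"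
proof
  assume "c \<in> code"
  then obtain f where "over_prime_field c" "degree c < n" "c = generator * f"
    unfolding code_def cyclic_code_def generator_eq by blast
  then show "over_prime_field c \<and> degree c < n \<and> poly c \<alpha> = 0 \<and> poly c (\<alpha> ^ e) = 0"
    by (simp add: generator_def poly_root_poly self_in_orbit)
next
  assume c: "over_prime_field c \<and> degree c < n \<and> poly c \<alpha> = 0 \<and> poly c (\<alpha> ^ e) = 0"
  then have "generator dvd c"
    unfolding generator_def by (intro root_poly_dvd) (auto simp: orbit_def poly_power_root)
  then obtain f where "c = generator * f" by blast
  with c show "c \<in> code"
    unfolding code_def cyclic_code_def generator_eq
    using over_prime_field_quotient over_prime_field_generator generator_neq_0 by blast
qed

lemma dimension_pos: "2 * m < n"
proof -
  have "2 * k + 1 < (3::nat) ^ k" if "k \<ge> 3" for k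
    using that by (induction k rule: dec_induct) simp_all
  from this[OF m_ge_3] show ?thesis by (simp add: n_def)
qed

text \<open>Multiplication by the generator, of degree \<open>2 * m\<close>, is a bijection from the
  polynomials over GF(3) of degree below \<open>n - 2 * m\<close> onto the code.\<close>

lemma card_code: "card code = 3 ^ (n - 2 * m)"
proof -
  let ?F = "{f. (\<forall>i. coeff f i \<in> prime_subfield) \<and> (\<forall>i\<ge>n - 2 * m. coeff f i = (0::'a))}"
  have F: "f \<in> ?F \<longleftrightarrow> over_prime_field f \<and> degree f < n - 2 * m" for f
    using dimension_pos
    by (auto simp: over_prime_field_def intro: degree_lessI coeff_eq_0)
  have "code = (\<lambda>f. generator * f) ` ?F"
  proof (intro set_eqI iffI)
    fix c assume "c \<in> code"
    then obtain f where f: "over_prime_field f" "degree c < n" "c = generator * f"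
      unfolding code_def cyclic_code_def generator_eq by blast
    moreover have "degree f < n - 2 * m"
      using f dimension_pos
      by (cases "f = 0") (simp_all add: degree_mult_eq generator_neq_0 degree_generator)
    ultimately show "c \<in> (\<lambda>f. generator * f) ` ?F" using F by blast
  next
    fix c assume "c \<in> (\<lambda>f. generator * f) ` ?F"
    then obtain f where f: "over_prime_field f" "degree f < n - 2 * m" "c = generator * f"
      using F by blast
    have "degree c < n"
      using f dimension_pos degree_mult_le[of generator f] by (simp add: degree_generator)
    then show "c \<in> code"
      unfolding code_def cyclic_code_def generator_eq
      using f over_prime_field_mult over_prime_field_generator by blast
  qed
  moreover have "inj_on (\<lambda>f. generator * f) ?F"
    by (auto simp: inj_on_def generator_neq_0)
  moreover have "card ?F = 3 ^ (n - 2 * m)"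
    by (subst card_polys_coeffs_in) (simp_all add: card_prime_subfield, simp add: prime_subfield_eq)
  ultimately show ?thesis by (simp add: card_image)
qed

section \<open>Bounds on the minimum weight\<close>

text \<open>Dividing by \<open>v\<close> reduces to \<open>x = u / v\<close>, where
  \<open>square_condition\<close> applies; evenness of \<open>e\<close> absorbs the sign of
  \<open>w\<close>. The value \<open>x = -1\<close> is excluded since it would make \<open>w\<close>
  vanish.\<close>

lemma three_term_equal:
  fixes u v w :: 'a
  assumes "even e" and no_small: "\<And>x::'a. x \<noteq> 0 \<Longrightarrow> x ^ e = 1 \<or> x ^ e = x \<Longrightarrow> x = 1 \<or> x = -1"
    and "u \<noteq> 0" "v \<noteq> 0" "w \<noteq> 0" "u + v + w = 0" "(w ^ e) ^ 2 = (u ^ e + v ^ e) ^ 2"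
  shows "u = v"
proof -
  define x where "x = u / v"
  have u: "u = x * v" using \<open>v \<noteq> 0\<close> by (simp add: x_def)
  have w: "w = - ((x + 1) * v)"
    using \<open>u + v + w = 0\<close> by (simp add: u algebra_simps eq_neg_iff_add_eq_0)
  have "w ^ e = (x + 1) ^ e * v ^ e"
    unfolding w using \<open>even e\<close> by (simp add: power_mult_distrib)
  then have "((x + 1) ^ e) ^ 2 * (v ^ e) ^ 2 = (x ^ e + 1) ^ 2 * (v ^ e) ^ 2"
    using \<open>(w ^ e) ^ 2 = _\<close> by (simp add: u power_mult_distrib algebra_simps flip: power_mult_distrib)
  then have "((x + 1) ^ e) ^ 2 = (x ^ e + 1) ^ 2"
    using \<open>v \<noteq> 0\<close> by simp
  moreover have "x \<noteq> 0" "x + 1 \<noteq> 0"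
    using \<open>u \<noteq> 0\<close> \<open>w \<noteq> 0\<close> u w by auto
  ultimately have "x = 1 \<or> x = -1"
    using no_small square_condition[OF e] by blast
  then show ?thesis using \<open>x + 1 \<noteq> 0\<close> u by auto
qed

lemma double_add_eq_0D:
  fixes x y :: 'a
  assumes "x + x + y = 0"
  shows "y = x"
proof -
  have "y = - (2 * x)" using minus_unique[OF assms] unfolding mult_2 by (rule sym)
  then show ?thesis by (simp add: two_eq)
qed

lemma signed_sum_square:
  fixes x y z :: 'a
  assumes "a \<in> {1, -1}" "c \<in> {1, -1}" "a * x + a * y + c * z = 0"
  shows "z ^ 2 = (x + y) ^ 2"
proof -
  have "c * z = - (a * (x + y))"
    using minus_unique[OF assms(3)] by (simp only: distrib_left)
  then have "(c * z) ^ 2 = (a * (x + y)) ^ 2" by simp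
  moreover have "a ^ 2 = 1" "c ^ 2 = 1" using assms by auto
  ultimately show ?thesis by (simp add: power_mult_distrib)
qed

lemma signed_three_term_equal:
  fixes u v w :: 'a
  assumes "even e" and no_small: "\<And>x::'a. x \<noteq> 0 \<Longrightarrow> x ^ e = 1 \<or> x ^ e = x \<Longrightarrow> x = 1 \<or> x = -1"
    and nz: "u \<noteq> 0" "v \<noteq> 0" "w \<noteq> 0"
    and sum: "u + v + w = 0" and psum: "a * u ^ e + b * v ^ e + c * w ^ e = 0"
    and signs: "a \<in> {1, -1}" "b \<in> {1, -1}" "c \<in> {1, -1}"
  shows "u = v \<and> a = b"
proof -
  note three = three_term_equal[OF assms(1) no_small]
  \<comment> \<open>Among three signs two agree. Squaring the equation eliminates the signs, and the
    agreeing pair plays the role of \<open>u\<close> and \<open>v\<close> in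
    \<open>three_term_equal\<close>.\<close>
  have "a = b \<or> a = c \<or> b = c"
    using signs by auto
  then have "u = v \<and> v = w"
  proof (elim disjE)
    assume "a = b"
    then have "(w ^ e) ^ 2 = (u ^ e + v ^ e) ^ 2"
      using signed_sum_square[OF signs(1,3)] psum by blast
    then have "u = v" using three[of u v w] nz sum by blast
    then show ?thesis using sum double_add_eq_0D[of u w] by simp
  next
    assume "a = c"
    then have "a * u ^ e + a * w ^ e + b * v ^ e = 0"
      using psum by (simp only: ac_simps)
    then have "(v ^ e) ^ 2 = (u ^ e + w ^ e) ^ 2"
      using signed_sum_square[OF signs(1,2)] by blast
    moreover have "u + w + v = 0" using sum by (simp only: ac_simps)
    ultimately have "u = w" using three[of u w v] nz by blast
    then show ?thesis using double_add_eq_0D[of u v] \<open>u + w + v = 0\<close> by simp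
  next
    assume "b = c"
    then have "b * v ^ e + b * w ^ e + a * u ^ e = 0"
      using psum by (simp only: ac_simps)
    then have "(u ^ e) ^ 2 = (v ^ e + w ^ e) ^ 2"
      using signed_sum_square[OF signs(2,1)] by blast
    moreover have "v + w + u = 0" using sum by (simp only: ac_simps)
    ultimately have "v = w" using three[of v w u] nz by blast
    then show ?thesis using double_add_eq_0D[of v u] \<open>v + w + u = 0\<close> by simp
  qed
  moreover from this have "(a + b + c) * u ^ e = 0"
    using psum by (simp add: distrib_right)
  \<comment> \<open>Three signs sum to zero in characteristic 3 only when all are equal.\<close>
  then have "a + b + c = 0" using nz by simp
  then have "a = b"
    using signs by auto
  ultimately show ?thesis by blast
qed

lemma weight_ge_4:
  assumes "even e" and no_small: "\<And>x::'a. x \<noteq> 0 \<Longrightarrow> x ^ e = 1 \<or> x ^ e = x \<Longrightarrow> x = 1 \<or> x = -1"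
    and "c \<in> code" "c \<noteq> 0"
  shows "4 \<le> hamming_weight c"
proof (rule ccontr)
  assume "\<not> 4 \<le> hamming_weight c"
  define S where "S = {i. coeff c i \<noteq> 0}"
  \<comment> \<open>The sign is absorbed into \<open>u i\<close>. As \<open>e\<close> is even,
    \<open>u i ^ e\<close> does not see it, so the two zeros of \<open>c\<close> become the two
    hypotheses of \<open>signed_three_term_equal\<close>.\<close>
  define u where "u i = coeff c i * \<alpha> ^ i" for i
  have c: "over_prime_field c" "degree c < n" "poly c \<alpha> = 0" "poly c (\<alpha> ^ e) = 0"
    using \<open>c \<in> code\<close> by (simp_all add: code_iff)
  have sign: "coeff c i \<in> {1, -1}" if "i \<in> S" for i
    using c(1) that by (auto simp: over_prime_field_def prime_subfield_eq S_def)
  have less: "i < n" if "i \<in> S" for i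
    using c(2) that le_degree[of c i] by (simp add: S_def)
  have finite: "finite S"
    using less by (intro finite_subset[of S "{..<n}"]) auto
  have nz: "u i \<noteq> 0" if "i \<in> S" for i
    using that by (simp add: u_def S_def primitive(1))
  have sum: "(\<Sum>i\<in>S. u i) = 0"
    using c(3) by (simp add: poly_eq_sum_support S_def u_def)
  have power_u: "u i ^ e = (\<alpha> ^ e) ^ i" if "i \<in> S" for i
    using sign[OF that] \<open>even e\<close> by (auto simp: u_def power_mult_distrib mult.commute simp flip: power_mult)
  have "(\<Sum>i\<in>S. coeff c i * u i ^ e) = (\<Sum>i\<in>S. coeff c i * (\<alpha> ^ e) ^ i)"
    by (intro sum.cong) (simp_all add: power_u)
  then have psum: "(\<Sum>i\<in>S. coeff c i * u i ^ e) = 0"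
    using c(4) by (simp add: poly_eq_sum_support S_def)
  have neq: "i = j" if "i \<in> S" "j \<in> S" "u i = u j" "coeff c i = coeff c j" for i j
  proof -
    have "\<alpha> ^ i = \<alpha> ^ j" using that by (simp add: u_def S_def)
    then show ?thesis using power_eq_iff less that by blast
  qed
  have "card S \<in> {1, 2, 3}"
  proof -
    have "S \<noteq> {}" using \<open>c \<noteq> 0\<close> by (auto simp: S_def poly_eq_iff)
    then have "card S \<noteq> 0" using finite by simp
    then show ?thesis using \<open>\<not> 4 \<le> _\<close> by (auto simp: hamming_weight_def S_def)
  qed
  then consider i where "S = {i}" | i j where "S = {i, j}" "i \<noteq> j"
    | i j k where "S = {i, j, k}" "i \<noteq> j" "j \<noteq> k" "i \<noteq> k"
    by (auto simp: card_1_singleton_iff card_2_iff card_3_iff)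
  then show False
  proof cases
    case 1
    then show False using sum nz by simp
  next
    case 2
    \<comment> \<open>The first equation negates \<open>u\<close>, the second negates the
      coefficient; together they give equal powers of \<alpha> at distinct positions.\<close>
    then have u: "u j = - u i" using sum by (simp add: add_eq_0_iff)
    then have "u j ^ e = u i ^ e" using \<open>even e\<close> by simp
    then have "(coeff c i + coeff c j) * u i ^ e = 0"
      using psum 2 by (simp add: algebra_simps)
    then have "coeff c j = - coeff c i" using nz[of i] 2 by (simp add: add_eq_0_iff)
    then have "\<alpha> ^ i = \<alpha> ^ j" using u 2 by (auto simp: u_def S_def)
    then show False using power_eq_iff less 2 by blast
  next
    case 3
    have "u i = u j \<and> coeff c i = coeff c j"
      by (rule signed_three_term_equal[OF assms(1) no_small, where w = "u k" and c = "coeff c k"])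
        (use 3 nz sign sum psum in \<open>auto simp: add.assoc\<close>)
    then show False using neq 3 by blast
  qed
qed

text \<open>A sphere-packing count: there are more words of weight 2 than syndromes.\<close>
lemma exists_weight_le_4:
  obtains c where "c \<in> code" "c \<noteq> 0" "hamming_weight c \<le> 4"
proof -
  define signs where "signs = {1, -1 :: 'a}"
  \<comment> \<open>Requiring \<open>j < i\<close> lists every word of weight 2 exactly once, which
    makes \<open>W\<close> injective.\<close>
  define T where "T = (SIGMA i:{..<n}. {..<i} \<times> signs \<times> signs)"
  define W where "W = (\<lambda>(i, j, a :: 'a, b). monom a i + monom b j)"
  define syndrome where "syndrome p = (poly p \<alpha>, poly p (\<alpha> ^ e))" for p
  have lead: "degree (W (i, j, a, b)) = i" "lead_coeff (W (i, j, a, b)) = a"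
    if "(i, j, a, b) \<in> T" for i j a b
  proof -
    have ij: "j < i" "a \<noteq> 0" using that by (auto simp: T_def signs_def)
    then have "degree (monom b j) < degree (monom a i)"
      using degree_monom_le[of b j] by (simp add: degree_monom_eq)
    then show "degree (W (i, j, a, b)) = i" "lead_coeff (W (i, j, a, b)) = a"
      using ij by (simp_all add: W_def degree_add_eq_left degree_monom_eq)
  qed
  have "inj_on W T"
  proof (rule inj_onI)
    fix t t' assume T: "t \<in> T" "t' \<in> T" and eq: "W t = W t'"
    obtain i j a b where t: "t = (i, j, a, b)" by (rule prod_cases4)
    obtain i' j' a' b' where t': "t' = (i', j', a', b')" by (rule prod_cases4)
    have "i = i'" "a = a'" using T eq lead unfolding t t' by metis+
    with eq have "monom b j = monom b' j'" by (simp add: W_def t t')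
    moreover have "b \<noteq> 0" "b' \<noteq> 0" using T by (auto simp: T_def signs_def t t')
    ultimately have "j = j'" "b = b'"
      by (metis degree_monom_eq, metis degree_monom_eq lead_coeff_monom)
    with \<open>i = i'\<close> \<open>a = a'\<close> show "t = t'" by (simp add: t t')
  qed
  \<comment> \<open>There are \<open>2 * n * n - 2 * n\<close> such words against
    \<open>(n + 1) * (n + 1)\<close> syndromes; \<open>n \<ge> 26\<close> is ample for the former to
    be larger.\<close>
  have "(\<Sum>i<k. i * 4) + 2 * k = 2 * k * k" for k :: nat
    by (induction k) (simp_all add: algebra_simps)
  moreover have "card signs = 2"
    using minus_one_neq_one[symmetric] by (simp add: signs_def)
  then have "card T = (\<Sum>i<n. i * 4)"
    by (simp add: T_def card_cartesian_product)
  ultimately have "card T + 2 * n = 2 * n * n" by simp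
  moreover have "n \<ge> 26" using power_bound n_eq by linarith
  then have "26 * n \<le> n * n" by simp
  ultimately have "(n + 1) * (n + 1) < card T"
    using \<open>n \<ge> 26\<close>
    by (simp only: distrib_left distrib_right mult_1 mult_1_right mult.assoc mult_2)
  moreover have "card (UNIV :: ('a \<times> 'a) set) = (n + 1) * (n + 1)"
    using n_pos by (simp add: card_cartesian_product card_field n_def flip: UNIV_Times_UNIV)
  moreover have "card (syndrome ` W ` T) \<le> card (UNIV :: ('a \<times> 'a) set)"
    by (intro card_mono) auto
  moreover have "card (W ` T) = card T"
    using \<open>inj_on W T\<close> by (rule card_image)
  ultimately have "\<not> inj_on syndrome (W ` T)"
    by (intro pigeonhole) linarith
  then obtain t t' where t: "t \<in> T" "t' \<in> T" "syndrome (W t) = syndrome (W t')" "W t \<noteq> W t'"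
    by (auto simp: inj_on_def)
  obtain i j a b where ti: "t = (i, j, a, b)" by (metis prod_cases4)
  obtain i' j' a' b' where ti': "t' = (i', j', a', b')" by (metis prod_cases4)
  have over: "over_prime_field (W t)" "over_prime_field (W t')"
    using t(1,2) by (auto simp: T_def signs_def W_def intro!: over_prime_field_add over_prime_field_monom)
  have "degree (W t) < n" "degree (W t') < n"
    using t(1,2) lead unfolding ti ti' by (auto simp: T_def)
  then have "degree (W t - W t') < n"
    by (rule degree_diff_less)
  \<comment> \<open>Equal syndromes make the difference vanish at both zeros, and its support lies
    in four positions.\<close>
  then have "W t - W t' \<in> code"
    using t(3) over by (simp add: code_iff over_prime_field_diff syndrome_def)
  moreover have "hamming_weight (W t - W t') \<le> card {i, j, i', j'}"
    by (rule hamming_weight_le) (auto simp: W_def ti ti')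
  moreover have "card {i, j, i', j'} \<le> 4"
    using card_length[of "[i, j, i', j']"] by simp
  ultimately show ?thesis
    using that[of "W t - W t'"] t(4) by simp
qed

section \<open>Codewords of weight at most three when the conditions fail\<close>

lemma even_if_weight_gt_2:
  assumes "\<And>c. c \<in> code \<Longrightarrow> c \<noteq> 0 \<Longrightarrow> 2 < hamming_weight c"
  shows "even e"
proof (rule ccontr)
  assume "odd e"
  have "even n" by (simp add: n_def)
  then obtain k where k: "n = 2 * k" by blast
  then have "0 < k" "k < n" using n_pos by simp_all
  have "(\<alpha> ^ k) ^ 2 = 1"
    using power_n[OF primitive(1)] by (simp add: k mult.commute flip: power_mult)
  moreover have "\<alpha> ^ k \<noteq> 1" using power_eq_iff[of k 0] \<open>0 < k\<close> \<open>k < n\<close> by simp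
  ultimately have "\<alpha> ^ k = -1" by (simp add: power2_eq_1_iff)
  define c where "c = monom 1 0 + monom (1::'a) k"
  have "(\<alpha> ^ e) ^ k = (\<alpha> ^ k) ^ e" by (simp add: mult.commute flip: power_mult)
  then have "(\<alpha> ^ e) ^ k = -1" using \<open>\<alpha> ^ k = -1\<close> \<open>odd e\<close> by simp
  moreover have "degree c < n"
    using \<open>k < n\<close> n_pos unfolding c_def by (intro degree_add_less) (simp_all add: degree_monom_eq)
  ultimately have "c \<in> code"
    using \<open>\<alpha> ^ k = -1\<close> over_prime_field_monom[of 1 0]
    by (simp add: code_iff c_def poly_monom over_prime_field_add over_prime_field_monom)
  moreover have "coeff c 0 \<noteq> 0" using \<open>0 < k\<close> by (simp add: c_def)
  then have "c \<noteq> 0" by auto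
  moreover have "hamming_weight c \<le> card {0, k}"
    by (rule hamming_weight_le) (auto simp: c_def)
  ultimately show False using assms[of c] \<open>0 < k\<close> by simp
qed

text \<open>A forbidden \<open>x\<close> yields the codeword \<open>1 + X^j - s X^k\<close>, where
  \<open>x = \<alpha> ^ j\<close>, \<open>s\<close> is the sign left open by the squared equation,
  and \<open>s * (x + 1) = \<alpha> ^ k\<close>.\<close>

lemma no_small_if_weight_gt_3:
  assumes "even e" and weight: "\<And>c. c \<in> code \<Longrightarrow> c \<noteq> 0 \<Longrightarrow> 3 < hamming_weight c"
    and "x \<noteq> 0" "x ^ e = 1 \<or> x ^ e = (x::'a)"
  shows "x = 1 \<or> x = -1"
proof (rule ccontr)
  assume contra: "\<not> (x = 1 \<or> x = -1)"
  then have "x + 1 \<noteq> 0" by (simp add: add_eq_0_iff2)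
  then have "((x + 1) ^ e) ^ 2 = (x ^ e + 1) ^ 2"
    using square_condition[OF e] assms(4) by blast
  then have "(x + 1) ^ e = 1 * (x ^ e + 1) \<or> (x + 1) ^ e = (-1) * (x ^ e + 1)"
    by (simp only: power2_eq_iff mult_1 mult_minus1)
  then obtain s where s: "s \<in> {1, -1}" "(x + 1) ^ e = s * (x ^ e + 1)" by blast
  then have ss: "s * s = 1" "s ^ e = 1" using \<open>even e\<close> by auto
  obtain j where j: "j < n" "x = \<alpha> ^ j" using \<open>x \<noteq> 0\<close> by (rule primitive_less)
  have "s * (x + 1) \<noteq> 0" using s(1) \<open>x + 1 \<noteq> 0\<close> by auto
  then obtain k where k: "k < n" "s * (x + 1) = \<alpha> ^ k" by (rule primitive_less)
  have j_power: "(\<alpha> ^ e) ^ j = x ^ e" by (simp add: j mult.commute flip: power_mult)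
  have "(\<alpha> ^ e) ^ k = (s * (x + 1)) ^ e" unfolding k(2) by (simp add: mult.commute flip: power_mult)
  also have "\<dots> = s * (x ^ e + 1)"
    by (simp only: power_mult_distrib ss s(2) mult_1)
  finally have "s * (\<alpha> ^ e) ^ k = x ^ e + 1" by (simp only: mult.assoc[symmetric] ss mult_1)
  moreover have "s * \<alpha> ^ k = x + 1" by (simp only: k(2)[symmetric] mult.assoc[symmetric] ss mult_1)
  moreover define c where "c = monom 1 0 + monom (1::'a) j + monom (- s) k"
  moreover have "over_prime_field c"
    unfolding c_def using s(1) by (intro over_prime_field_add over_prime_field_monom) auto
  moreover have "degree c < n"
    using j(1) k(1) n_pos unfolding c_def
    by (intro degree_add_less) (use s(1) in \<open>auto simp: degree_monom_eq\<close>)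
  ultimately have "c \<in> code"
    by (simp add: code_iff poly_monom j_power j(2)[symmetric])
  moreover have "j \<noteq> 0" using contra j by (intro notI) simp
  \<comment> \<open>Distinct positions keep the word nonzero. Coincidence would mean
    \<open>s * (x + 1) = x\<close>: impossible for \<open>s = 1\<close>, while \<open>s = -1\<close>
    forces \<open>x = 1\<close>.\<close>
  have "j \<noteq> k"
  proof
    assume "j = k"
    then have "s * (x + 1) = x" using j k by simp
    then have "- (x + 1) = x" using s(1) by auto
    then have "x + x + 1 = 0" by (metis ab_left_minus add.assoc)
    then show False using contra double_add_eq_0D by blast
  qed
  then have "coeff c j \<noteq> 0" using \<open>j \<noteq> 0\<close> by (simp add: c_def)
  then have "c \<noteq> 0" by auto
  moreover have "hamming_weight c \<le> card {0, j, k}"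
    by (rule hamming_weight_le) (auto simp: c_def)
  moreover have "card {0, j, k} \<le> 3"
    using card_length[of "[0, j, k]"] by simp
  ultimately show False using weight[of c] by simp
qed

section \<open>From code parameters to conditions on h and m\<close>

lemma params_iff:
  "ternary_code_params code n (n - 2 * m) 4 \<longleftrightarrow>
     even e \<and> (\<forall>x::'a. x \<noteq> 0 \<longrightarrow> x ^ e = 1 \<or> x ^ e = x \<longrightarrow> x = 1 \<or> x = -1)"
  (is "?L \<longleftrightarrow> even e \<and> ?R")
proof
  assume ?L
  then have weight: "4 \<le> hamming_weight c" if "c \<in> code" "c \<noteq> 0" for c
    using that unfolding ternary_code_params_def by blast
  have "2 < hamming_weight c" "3 < hamming_weight c" if "c \<in> code" "c \<noteq> 0" for c
    using weight[OF that] by simp_all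
  then have "even e" ?R
    using even_if_weight_gt_2 no_small_if_weight_gt_3 by blast+
  then show "even e \<and> ?R" by blast
next
  assume R: "even e \<and> ?R"
  then have weight: "4 \<le> hamming_weight c" if "c \<in> code" "c \<noteq> 0" for c
    using that by (intro weight_ge_4) auto
  obtain c where c: "c \<in> code" "c \<noteq> 0" "hamming_weight c \<le> 4" by (rule exists_weight_le_4)
  then have "hamming_weight c = 4" using weight by (simp add: le_antisym)
  with c weight show ?L
    unfolding ternary_code_params_def using card_code by (auto simp: code_iff)
qed

text \<open>Since \<open>2 * e + 1 = 3 ^ h\<close>, the case \<open>x ^ e = 1\<close> gives a fixed
  point of the \<open>h\<close>-th Frobenius iterate, and \<open>x ^ e = x\<close> one of the
  iterate before it. Coprimality with \<open>m\<close> leaves only the prime field.\<close>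

lemma no_small_iff:
  "(\<forall>x::'a. x \<noteq> 0 \<longrightarrow> x ^ e = 1 \<or> x ^ e = x \<longrightarrow> x = 1 \<or> x = -1) \<longleftrightarrow>
     gcd h m = 1 \<and> gcd (h - 1) m = 1"
  (is "?L \<longleftrightarrow> _")
proof -
  obtain e' where e': "2 * e' + 1 = (3::nat) ^ (h - 1)" by (rule odd_power_half)
  have "(3::nat) ^ h = 3 * 3 ^ (h - 1)" using h_ge_2 by (simp flip: power_Suc)
  \<comment> \<open>With this form of \<open>e\<close>, \<open>x ^ e' = 1\<close> implies
    \<open>x ^ e = x\<close>, so the order argument for \<open>h\<close> applies verbatim to
    \<open>h - 1\<close>.\<close>
  then have e_eq: "e = e' * 3 + 1" using e e' by simp
  show ?thesis
  proof
    assume ?L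
    have "gcd h m = 1"
      by (rule gcd_eq_1_if_no_small_order[OF e]) (use \<open>?L\<close> in blast)
    moreover have "gcd (h - 1) m = 1"
    proof (rule gcd_eq_1_if_no_small_order[OF e'])
      fix x :: 'a assume "x \<noteq> 0" "x ^ e' = 1"
      moreover from this have "x ^ e = x" by (simp add: e_eq power_mult)
      ultimately show "x = 1 \<or> x = -1" using \<open>?L\<close> by blast
    qed
    ultimately show "gcd h m = 1 \<and> gcd (h - 1) m = 1" ..
  next
    assume gcds: "gcd h m = 1 \<and> gcd (h - 1) m = 1"
    show ?L
    proof (intro allI impI)
      fix x :: 'a assume "x \<noteq> 0" and "x ^ e = 1 \<or> x ^ e = x"
      have "x ^ 3 ^ h = x ^ e * x ^ e * x"
        by (simp flip: e add: mult_2 power_add)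
      from \<open>x ^ e = 1 \<or> x ^ e = x\<close> have "x ^ 3 = x"
      proof
        assume "x ^ e = 1"
        then have "x ^ 3 ^ h = x" using \<open>x ^ 3 ^ h = _\<close> by simp
        then show ?thesis by (rule frobenius_fixed_coprime) (use gcds in simp)
      next
        assume "x ^ e = x"
        then have "x ^ 3 ^ h = x ^ 3" using \<open>x ^ 3 ^ h = _\<close> by (simp add: power3_eq_cube)
        then have "(x ^ 3 ^ (h - 1)) ^ 3 = x ^ 3"
          using \<open>3 ^ h = 3 * 3 ^ (h - 1)\<close> by (simp add: mult.commute flip: power_mult)
        then have "x ^ 3 ^ (h - 1) = x" by (simp add: cube_eq_iff)
        then show ?thesis by (rule frobenius_fixed_coprime) (use gcds in simp)
      qed
      then show "x = 1 \<or> x = -1" using \<open>x \<noteq> 0\<close> cube_fixed_iff by blast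
    qed
  qed
qed

text \<open>The parity of \<open>e\<close> is read off from \<open>3 ^ h = 2 * e + 1\<close> modulo
  4.\<close>

lemma even_e_iff: "even e \<longleftrightarrow> even h"
proof -
  have "(3::nat) ^ k mod 4 = (if even k then 1 else 3)" for k
    by (induction k) (auto simp: mod_mult_right_eq[of 3 "3 ^ _" 4, symmetric])
  from this[of h] show ?thesis
    unfolding e[symmetric] by (cases "even h") (presburger+)
qed

end

theorem theorem6:
  fixes \<alpha> :: "'a::{field,finite}" and m h :: nat
  assumes "m \<ge> 3" and "card (UNIV :: 'a set) = 3 ^ m"
    and "2 \<le> h" and "h \<le> m - 1"
    and "\<alpha> \<noteq> 0" and "\<forall>x::'a. x \<noteq> 0 \<longrightarrow> (\<exists>k::nat. \<alpha> ^ k = x)"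
  shows "ternary_code_params
           (cyclic_code (3 ^ m - 1) (min_poly \<alpha> * min_poly (\<alpha> ^ ((3 ^ h - 1) div 2))))
           (3 ^ m - 1) (3 ^ m - 1 - 2 * m) 4
         \<longleftrightarrow> odd m \<and> even h \<and> gcd h m = 1 \<and> gcd (h - 1) m = 1"
proof -
  define e :: nat where "e = (3 ^ h - 1) div 2"
  have "odd (3 ^ h :: nat)" by simp
  then have "2 * e + 1 = 3 ^ h" unfolding e_def by (simp add: odd_two_times_div_two_succ)
  then interpret ternary_code \<alpha> m h e
    by unfold_locales (use assms in auto)
  \<comment> \<open>If \<open>h\<close> and \<open>m\<close> were both even, 2 would divide their
    gcd.\<close>
  have "odd m" if "even h" "gcd h m = 1"
    using that gcd_greatest[of 2 h m] by auto
  moreover have "ternary_code_params code n (n - 2 * m) 4 \<longleftrightarrow>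
      even h \<and> gcd h m = 1 \<and> gcd (h - 1) m = 1"
    unfolding params_iff no_small_iff even_e_iff ..
  ultimately show ?thesis
    unfolding code_def unfolding n_def e_def by argo
qed

end
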